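(* For any tree $T$ of order $n\ge 2$ and for any positive integer $k$, $\gamma_L^k(T)\le n-ex(T)$.
   Context: All graphs are finite, simple, undirected and connected. $d(x,y)$ is the length of a shortest path between $x$ and $y$ in a graph $G$. For a positive integer $k$, let $d_k(x,y)=\min\{d(x,y),k+1\}$. A set $D\subseteq V(G)$ is a distance-$k$ dominating set of $G$ if for each $u\in V(G)\setminus D$ there is $w\in D$ with $d(u,w)\le k$. A set $S\subseteq V(G)$ is a distance-$k$ resolving set of $G$ if for any distinct $x,y\in V(G)$ there is $z\in S$ with $d_k(x,z)\ne d_k(y,z)$. A distance-$k$ locating-dominating set of $G$ is a set $S\subseteq V(G)$ that is both a distance-$k$ dominating set and a distance-$k$ resolving set of $G$; the distance-$k$ location-domination number $\gamma_L^k(G)$ is the minimum cardinality of such a set. A major vertex is a vertex of degree at least three; a leaf is a vertex of degree one. A leaf $\ell$ is a terminal vertex of a major vertex $v$ if $d(\ell,v)<d(\ell,w)$ for every other major vertex $w$. The terminal degree of a major vertex $v$ is the number of terminal vertices of $v$. An exterior major vertex is a major vertex of positive terminal degree, and $ex(G)$ is the number of exterior major vertices of $G$. *)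

theory Defs
  imports "Graph_Theory.Digraph_Component"
begin

text \<open>
  Finite simple undirected graphs are the instances of the locale \<^locale>\<open>graph\<close>: finite
  symmetric digraphs without loops or parallel arcs. Each edge is a pair of opposite arcs, so the
  degree of a vertex is its \<^const>\<open>out_degree\<close>.
\<close>

text \<open>
  The library predicates \<open>forest\<close> and \<open>tree\<close> are not usable here: in a symmetric digraph
  every edge traversed back and forth counts as a \<^const>\<open>pre_digraph.cycle\<close> of length 2. The
  cycles of the underlying undirected simple graph are exactly those of length at least 3.
\<close>
definition tree_graph :: "('a, 'b) pre_digraph \<Rightarrow> bool" where
  "tree_graph G \<longleftrightarrow> graph G \<and> connected G \<and>
     \<not> (\<exists>p. pre_digraph.cycle G p \<and> 3 \<le> length p)"

text \<open>Only meaningful if \<open>y\<close> is reachable from \<open>x\<close>.\<close>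
definition gdist :: "('a, 'b) pre_digraph \<Rightarrow> 'a \<Rightarrow> 'a \<Rightarrow> nat" where
  "gdist G x y = (LEAST n. \<exists>p. pre_digraph.apath G x p y \<and> length p = n)"

definition gdist_trunc :: "('a, 'b) pre_digraph \<Rightarrow> nat \<Rightarrow> 'a \<Rightarrow> 'a \<Rightarrow> nat" where
  "gdist_trunc G k x y = min (gdist G x y) (k + 1)"

definition distance_dominating :: "('a, 'b) pre_digraph \<Rightarrow> nat \<Rightarrow> 'a set \<Rightarrow> bool" where
  "distance_dominating G k D \<longleftrightarrow> D \<subseteq> verts G \<and>
     (\<forall>u \<in> verts G - D. \<exists>w \<in> D. gdist G u w \<le> k)"

definition distance_resolving :: "('a, 'b) pre_digraph \<Rightarrow> nat \<Rightarrow> 'a set \<Rightarrow> bool" where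
  "distance_resolving G k S \<longleftrightarrow> S \<subseteq> verts G \<and>
     (\<forall>x \<in> verts G. \<forall>y \<in> verts G. x \<noteq> y \<longrightarrow>
        (\<exists>z \<in> S. gdist_trunc G k x z \<noteq> gdist_trunc G k y z))"

definition distance_locating_dominating :: "('a, 'b) pre_digraph \<Rightarrow> nat \<Rightarrow> 'a set \<Rightarrow> bool" where
  "distance_locating_dominating G k S \<longleftrightarrow>
     distance_dominating G k S \<and> distance_resolving G k S"

definition location_domination_number :: "('a, 'b) pre_digraph \<Rightarrow> nat \<Rightarrow> nat" where
  "location_domination_number G k =
     (LEAST m. \<exists>S. distance_locating_dominating G k S \<and> card S = m)"

definition major_vertex :: "('a, 'b) pre_digraph \<Rightarrow> 'a \<Rightarrow> bool" where
  "major_vertex G v \<longleftrightarrow> v \<in> verts G \<and> 3 \<le> out_degree G v"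

definition leaf :: "('a, 'b) pre_digraph \<Rightarrow> 'a \<Rightarrow> bool" where
  "leaf G l \<longleftrightarrow> l \<in> verts G \<and> out_degree G l = 1"

definition terminal_vertex :: "('a, 'b) pre_digraph \<Rightarrow> 'a \<Rightarrow> 'a \<Rightarrow> bool" where
  "terminal_vertex G v l \<longleftrightarrow> major_vertex G v \<and> leaf G l \<and>
     (\<forall>w. major_vertex G w \<and> w \<noteq> v \<longrightarrow> gdist G l v < gdist G l w)"

definition terminal_degree :: "('a, 'b) pre_digraph \<Rightarrow> 'a \<Rightarrow> nat" where
  "terminal_degree G v = card {l. terminal_vertex G v l}"

definition exterior_major_vertex :: "('a, 'b) pre_digraph \<Rightarrow> 'a \<Rightarrow> bool" where
  "exterior_major_vertex G v \<longleftrightarrow> major_vertex G v \<and> 0 < terminal_degree G v"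

definition ex_number :: "('a, 'b) pre_digraph \<Rightarrow> nat" where
  "ex_number G = card {v. exterior_major_vertex G v}"

end

theory Submission
  imports Defs
begin

text \<open>
  Choose one terminal vertex for each exterior major vertex and remove these leaves from the vertex
  set. Each removed leaf keeps its neighbour, which dominates it and separates it from every other
  removed leaf that hangs elsewhere. Two leaves with a common neighbour are equidistant from every
  other vertex, so they are terminal vertices of the same major vertex and at most one of them is
  removed. Acyclicity plays no role.
\<close>

lemma out_arcs_singletonD:
  assumes "out_arcs G v = {e}"
  shows "e \<in> arcs G" "tail G e = v"
proof -
  have "e \<in> out_arcs G v"
    using assms by blast
  then show "e \<in> arcs G" "tail G e = v"
    by simp_all
qed

context wf_digraph
begin

text \<open>Shortcutting a walk to a path keeps only arcs of the walk. A path has distinct vertices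
  and hence distinct arcs, so its length is the size of its arc set, which is at most the length of
  the walk.\<close>

lemma gdist_le_awalk:
  assumes "awalk x p y"
  shows "gdist G x y \<le> length p"
proof -
  let ?q = "awalk_to_apath p"
  have q: "apath x ?q y"
    using assms by (rule apath_awalk_to_apath)
  then have "distinct ?q"
    by (auto simp: apath_def intro: distinct_verts_imp_distinct)
  then have "length ?q = card (set ?q)"
    by (simp add: distinct_card)
  also have "\<dots> \<le> card (set p)"
    using awalk_to_apath_subset[OF assms] by (simp add: card_mono)
  also have "\<dots> \<le> length p"
    by (rule card_length)
  finally have "length ?q \<le> length p" .
  moreover have "gdist G x y \<le> length ?q"
    unfolding gdist_def using q by (blast intro: Least_le)
  ultimately show ?thesis by simp
qed

text \<open>Reachability makes the set of path lengths nonempty, so the \<open>LEAST\<close> in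
  \<open>gdist\<close> is attained.\<close>

lemma gdist_apathE:
  assumes "x \<rightarrow>\<^sup>*\<^bsub>G\<^esub> y"
  obtains p where "apath x p y" "length p = gdist G x y"
proof -
  have "\<exists>n p. apath x p y \<and> length p = n"
    using assms by (auto simp: reachable_apath)
  then have "\<exists>p. apath x p y \<and> length p = gdist G x y"
    unfolding gdist_def by (rule LeastI_ex)
  then show thesis using that by blast
qed

lemma gdist_self:
  assumes "x \<in> verts G"
  shows "gdist G x x = 0"
  using gdist_le_awalk[of x "[]" x] assms by (simp add: awalk_Nil_iff)

lemma gdist_pos:
  assumes "x \<rightarrow>\<^sup>*\<^bsub>G\<^esub> y" "x \<noteq> y"
  shows "0 < gdist G x y"
proof -
  obtain p where p: "apath x p y" "length p = gdist G x y"
    using assms(1) by (rule gdist_apathE)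
  then have "p \<noteq> []"
    using assms(2) by (auto simp: apath_Nil_iff)
  then show ?thesis
    using p(2) by (cases p) auto
qed

text \<open>Every path from \<open>l\<close> to another vertex starts with \<open>e\<close>.
  Dropping \<open>e\<close> from a shortest path gives one inequality. Prepending \<open>e\<close>
  to a shortest path from \<open>head G e\<close> gives the other; the result is only known to be a
  walk, which suffices by \<open>gdist_le_awalk\<close>.\<close>

lemma gdist_out_arcs_single:
  assumes out: "out_arcs G l = {e}" and reach: "l \<rightarrow>\<^sup>*\<^bsub>G\<^esub> x" and "x \<noteq> l"
  shows "gdist G l x = Suc (gdist G (head G e) x)"
proof (rule antisym)
  obtain p where p: "apath l p x" "length p = gdist G l x"
    using reach by (rule gdist_apathE)
  have e: "e \<in> arcs G" "tail G e = l"
    by (rule out_arcs_singletonD[OF out])+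
  obtain a q where a: "p = a # q"
    using p \<open>x \<noteq> l\<close> by (cases p) (auto simp: apath_Nil_iff)
  then have "a \<in> out_arcs G l"
    using p by (simp add: apath_Cons_iff)
  then have q: "apath (head G e) q x"
    using p a out by (simp add: apath_Cons_iff)
  then show "Suc (gdist G (head G e) x) \<le> gdist G l x"
    using gdist_le_awalk[OF awalkI_apath[OF q]] p(2) a by simp
  have "head G e \<rightarrow>\<^sup>*\<^bsub>G\<^esub> x"
    using q by (auto simp: reachable_apath)
  then obtain r where r: "apath (head G e) r x" "length r = gdist G (head G e) x"
    by (rule gdist_apathE)
  have "awalk l (e # r) x"
    using e awalkI_apath[OF r(1)] by (simp add: awalk_Cons_iff)
  then show "gdist G l x \<le> Suc (gdist G (head G e) x)"
    using gdist_le_awalk[of l "e # r" x] r(2) by simp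
qed

end

lemma leaf_major_neq:
  assumes "leaf G l" "major_vertex G v"
  shows "l \<noteq> v"
  using assms by (auto simp: leaf_def major_vertex_def)

text \<open>The additive form avoids truncated subtraction on \<open>nat\<close>. The witness is
  \<open>S\<close>, the complement of the set \<open>L\<close> of chosen leaves.\<close>

lemma (in graph) location_domination_number_le:
  assumes "connected G" and k: "k \<ge> 1"
  shows "location_domination_number G k + ex_number G \<le> card (verts G)"
proof -
  \<comment> \<open>\<open>connected\<close> refers to the symmetric closure; since the arcs are
    symmetric, it yields reachability in \<open>G\<close> itself, as \<open>gdist\<close>
    requires.\<close>
  have reach: "x \<rightarrow>\<^sup>*\<^bsub>G\<^esub> y" if "x \<in> verts G" "y \<in> verts G" for x y
    using symmetric_connected_imp_strongly_connected[OF sym_arcs \<open>connected G\<close>] that by blast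
  define X where "X = {v. exterior_major_vertex G v}"
  have finX: "finite X"
    by (rule finite_subset[OF _ finite_verts])
      (auto simp: X_def exterior_major_vertex_def major_vertex_def)
  have "\<exists>l. terminal_vertex G v l" if "v \<in> X" for v
    using that by (auto simp: X_def exterior_major_vertex_def terminal_degree_def card_gt_0_iff)
  then obtain t where t: "\<And>v. v \<in> X \<Longrightarrow> terminal_vertex G v (t v)"
    by metis
  define L where "L = t ` X"
  define S where "S = verts G - L"
  have leafL: "leaf G l" if "l \<in> L" for l
    using that t by (auto simp: L_def terminal_vertex_def)
  then have L_verts: "L \<subseteq> verts G"
    by (auto simp: leaf_def)
  \<comment> \<open>A leaf cannot be strictly closer to each of two major vertices than to the
    other.\<close>
  have inj: "inj_on t X"
  proof (rule inj_onI, rule ccontr)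
    fix v w assume vw: "v \<in> X" "w \<in> X" "t v = t w" "v \<noteq> w"
    then have "gdist G (t v) v < gdist G (t v) w" "gdist G (t w) w < gdist G (t w) v"
      using t[OF vw(1)] t[OF vw(2)] by (auto simp: terminal_vertex_def)
    then show False using vw by simp
  qed
  have "\<exists>e. out_arcs G l = {e}" if "l \<in> L" for l
    using leafL[OF that] by (auto simp: leaf_def out_degree_def card_1_singleton_iff)
  then obtain a where a: "\<And>l. l \<in> L \<Longrightarrow> out_arcs G l = {a l}"
    by metis
  define u where "u l = head G (a l)" for l
  have u_verts: "u l \<in> verts G" and u_neq: "u l \<noteq> l" if "l \<in> L" for l
  proof -
    have "a l \<in> arcs G" "tail G (a l) = l"
      by (rule out_arcs_singletonD[OF a[OF that]])+
    then show "u l \<in> verts G" "u l \<noteq> l"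
      using no_loops[of "a l"] by (auto simp: u_def)
  qed
  have dist: "gdist G l x = Suc (gdist G (u l) x)" if "l \<in> L" "x \<in> verts G" "x \<noteq> l" for l x
    unfolding u_def using gdist_out_arcs_single[OF a] reach L_verts that by blast
  have dist_u: "gdist G l (u l) = 1" if "l \<in> L" for l
    using dist[OF that u_verts[OF that] u_neq[OF that]] gdist_self u_verts[OF that] by simp
  have same: "l = m" if lm: "l \<in> L" "m \<in> L" "u l = u m" for l m
  proof (rule ccontr)
    assume "l \<noteq> m"
    obtain v w where vw: "v \<in> X" "l = t v" "w \<in> X" "m = t w"
      using lm by (auto simp: L_def)
    then have tv: "terminal_vertex G v l" and tw: "terminal_vertex G w m"
      using t by auto
    then have major: "major_vertex G v" "major_vertex G w"
      by (auto simp: terminal_vertex_def)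
    \<comment> \<open>A major vertex is neither \<open>l\<close> nor \<open>m\<close>, so both
      distances pass through the common neighbour and agree. The strict inequalities for
      \<open>v\<close> and \<open>w\<close> below then contradict each other.\<close>
    have "gdist G l x = gdist G m x" if "major_vertex G x" for x
      using dist[of l x] dist[of m x] lm leaf_major_neq[OF leafL that, symmetric] that
      by (simp add: major_vertex_def)
    moreover have "v \<noteq> w"
      using vw \<open>l \<noteq> m\<close> by auto
    then have "gdist G l v < gdist G l w" "gdist G m w < gdist G m v"
      using tv tw major by (auto simp: terminal_vertex_def)
    ultimately show False using major by simp
  qed
  \<comment> \<open>If \<open>u l\<close> were removed too, \<open>l\<close> and \<open>u l\<close>
    would be leaves joined to each other. A shortest path from \<open>l\<close> to the major vertex
    \<open>v\<close> would then step to \<open>u l\<close> and back to \<open>l\<close>, making the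
    distance exceed itself by two.\<close>
  have u_S: "u l \<in> S" if "l \<in> L" for l
  proof (rule ccontr)
    assume "u l \<notin> S"
    then have m: "u l \<in> L"
      using u_verts[OF that] by (simp add: S_def)
    obtain v where v: "v \<in> X" "l = t v"
      using \<open>l \<in> L\<close> by (auto simp: L_def)
    then have v_major: "major_vertex G v"
      using t by (auto simp: terminal_vertex_def)
    have neq: "v \<noteq> l" "v \<noteq> u l"
      using leaf_major_neq[OF leafL v_major] that m by auto
    have "u (u l) = l"
    proof -
      have al: "a l \<in> arcs G" "tail G (a l) = l"
        by (rule out_arcs_singletonD[OF a[OF that]])+
      \<comment> \<open>The reverse of \<open>a l\<close> leaves the leaf \<open>u l\<close>, so it
        must be its only outgoing arc.\<close>
      then obtain b where "b \<in> arcs G" "tail G b = u l" "head G b = l"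
        using sym_arcs unfolding symmetric_conv u_def by metis
      moreover from this have "b \<in> out_arcs G (u l)"
        by simp
      then have "b = a (u l)"
        using a[OF m] by simp
      ultimately show ?thesis by (simp add: u_def)
    qed
    then have "gdist G l v = Suc (Suc (gdist G l v))"
      using dist[OF that _ neq(1)] dist[OF m _ neq(2)] v_major by (simp add: major_vertex_def)
    then show False by simp
  qed
  have "distance_dominating G k S"
    unfolding distance_dominating_def
  proof (intro conjI ballI)
    fix l assume "l \<in> verts G - S"
    then have "l \<in> L" by (simp add: S_def)
    then show "\<exists>w\<in>S. gdist G l w \<le> k"
      using u_S dist_u k by (intro bexI[of _ "u l"]) auto
  qed (simp add: S_def)
  moreover have "distance_resolving G k S"
    unfolding distance_resolving_def
  proof (intro conjI ballI impI)
    fix x y assume xy: "x \<in> verts G" "y \<in> verts G" "x \<noteq> y"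
    consider "x \<in> S" | "y \<in> S" | "x \<in> L" "y \<in> L"
      using xy by (auto simp: S_def)
    then show "\<exists>z\<in>S. gdist_trunc G k x z \<noteq> gdist_trunc G k y z"
    proof cases
      \<comment> \<open>A vertex of \<open>S\<close> separates itself from any other: its own
        truncated distance is 0, the other is positive.\<close>
      case 1
      then show ?thesis
        using gdist_self gdist_pos[OF reach] xy by (intro bexI[of _ x]) (auto simp: gdist_trunc_def)
    next
      case 2
      then show ?thesis
        using gdist_self gdist_pos[OF reach, of x y] xy
        by (intro bexI[of _ y]) (auto simp: gdist_trunc_def)
    next
      \<comment> \<open>The separating vertex is \<open>u x\<close>, at distance 1 from
        \<open>x\<close>. Its distance from \<open>y\<close> is at least 2 because
        \<open>u y\<close> differs from \<open>u x\<close>, and truncation at \<open>k + 1\<close>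
        preserves the difference since \<open>k + 1\<close> is at least 2.\<close>
      case 3
      have "u x \<noteq> y"
        using u_S[OF 3(1)] 3(2) by (auto simp: S_def)
      then have "gdist G y (u x) = Suc (gdist G (u y) (u x))"
        using dist 3 u_verts by blast
      moreover have "0 < gdist G (u y) (u x)"
        using same 3 xy by (intro gdist_pos reach u_verts) auto
      ultimately show ?thesis
        using dist_u[OF 3(1)] u_S[OF 3(1)] k
        by (intro bexI[of _ "u x"]) (auto simp: gdist_trunc_def)
    qed
  qed (simp add: S_def)
  ultimately have "location_domination_number G k \<le> card S"
    unfolding location_domination_number_def distance_locating_dominating_def
    by (blast intro: Least_le)
  moreover have "card S + ex_number G = card (verts G)"
  proof -
    have "card L = ex_number G"
      using card_image[OF inj] by (simp add: L_def X_def ex_number_def)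
    \<comment> \<open>The bound on \<open>card L\<close> from \<open>card_mono\<close> makes the
      subtraction in \<open>card_Diff_subset\<close> exact.\<close>
    then show ?thesis
      using L_verts finite_verts finX card_mono[OF finite_verts L_verts]
      by (simp add: S_def card_Diff_subset finite_subset)
  qed
  ultimately show ?thesis by simp
qed

theorem proposition3p11:
  fixes T :: "('a, 'b) pre_digraph" and n k :: nat
  assumes "tree_graph T"
    and "card (verts T) = n"
    and "n \<ge> 2"
    and "k \<ge> 1"
  shows "int (location_domination_number T k) \<le> int n - int (ex_number T)"
  using assms graph.location_domination_number_le[of T k] by (simp add: tree_graph_def)

end
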